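(* Let $G$ be an Euler graph with at most two types of cycles (i.e. the lengths of all cycles of $G$ lie in at most two residue classes modulo $4$). Then $G$ is regular if and only if $G$ is an odd cycle graph or a regular bipartite Euler graph.
   Context: All graphs are finite, simple and connected. An Euler graph is a connected graph with at least one edge all of whose nodes have even degree. A cycle of length $n$ is of type $i$ if $n\equiv i\pmod 4$. An odd cycle graph is a graph consisting of a single cycle of odd length. *)

theory Defs
  imports "Graph_Theory.Graph_Theory"
begin

text \<open>
  A finite simple graph is a \<^const>\<open>pair_graph\<close>: each undirected edge \<open>uv\<close> is represented by
  the two arcs \<open>(u, v)\<close> and \<open>(v, u)\<close>. Hence the degree of a vertex is its \<^const>\<open>out_degree\<close>
  (which equals its \<^const>\<open>in_degree\<close>).
\<close>

definition euler_graph :: "'a pair_pre_digraph \<Rightarrow> bool" where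
  "euler_graph G \<longleftrightarrow> pair_graph G \<and> Digraph_Component.connected (with_proj G) \<and> parcs G \<noteq> {} \<and>
     (\<forall>v \<in> pverts G. even (out_degree (with_proj G) v))"

text \<open>
  \<^const>\<open>pre_digraph.cycle\<close> is the directed notion and also admits the closed walks \<open>u, v, u\<close>
  along a single undirected edge; the bound on the length excludes exactly these.
\<close>

definition graph_cycle :: "'a pair_pre_digraph \<Rightarrow> ('a \<times> 'a) awalk \<Rightarrow> bool" where
  "graph_cycle G p \<longleftrightarrow> pre_digraph.cycle (with_proj G) p \<and> 3 \<le> length p"

definition cycle_types :: "'a pair_pre_digraph \<Rightarrow> nat set" where
  "cycle_types G = {length p mod 4 | p. graph_cycle G p}"

definition regular_graph :: "'a pair_pre_digraph \<Rightarrow> bool" where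
  "regular_graph G \<longleftrightarrow> (\<exists>k. \<forall>v \<in> pverts G. out_degree (with_proj G) v = k)"

definition bipartite_graph :: "'a pair_pre_digraph \<Rightarrow> bool" where
  "bipartite_graph G \<longleftrightarrow>
     (\<exists>U V. pverts G = U \<union> V \<and> U \<inter> V = {} \<and> parcs G \<subseteq> (U \<times> V) \<union> (V \<times> U))"

definition odd_cycle_graph :: "'a pair_pre_digraph \<Rightarrow> bool" where
  "odd_cycle_graph G \<longleftrightarrow> pair_graph G \<and>
     (\<exists>p. graph_cycle G p \<and> odd (length p) \<and>
          pverts G = fst ` set p \<and> parcs G = set p \<union> (set p)\<inverse>)"

end

theory Submission
  imports Defs
begin

text \<open>
  Let \<open>v\<^sub>0 v\<^sub>1 \<dots>\<close> be a longest path, so that all neighbours of \<open>v\<^sub>0\<close> lie on it. If \<open>v\<^sub>0\<close> is adjacent to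
  \<open>v\<^sub>i\<close> and \<open>v\<^sub>j\<close> with \<open>i < j\<close>, there is a cycle of length \<open>j - i + 2\<close>. If every degree is at least 4 and
  there are at most two types, the pigeonhole principle yields two neighbours with \<open>j - i\<close> divisible
  by 4, hence a cycle of type 2. If moreover the graph is not bipartite, the types are exactly 2
  and some odd \<open>b\<close>.

  In a graph whose cycles all have type 2 or \<open>b\<close>, no cycle has two crossing chords: the cycle, the
  four cycles using one chord and the two cycles using both have incompatible lengths modulo 4.
  Among the longest paths choose one for which the least \<open>a \<ge> 2\<close> with \<open>v\<^sub>0\<close> adjacent to \<open>v\<^sub>a\<close> is minimal.
  The path \<open>v\<^sub>a\<^sub>-\<^sub>1 \<dots> v\<^sub>0 v\<^sub>a v\<^sub>a\<^sub>+\<^sub>1 \<dots>\<close> is also longest, and as chords do not cross, all neighbours of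
  \<open>v\<^sub>a\<^sub>-\<^sub>1\<close> are among \<open>v\<^sub>0, \<dots>, v\<^sub>a\<close>. Since there are at least three of them, the new path has a smaller \<open>a\<close>,
  a contradiction. So a non-bipartite regular graph of even degree with at most two types has
  degree 2 and is an odd cycle.
\<close>

section \<open>Paths and cycles as vertex lists\<close>

text \<open>Vertices are listed instead of arcs so that cutting, reversing and splicing paths become
  plain list operations.\<close>

definition path_list :: "('a \<times> 'a) set \<Rightarrow> 'a list \<Rightarrow> bool" where
  "path_list E xs \<longleftrightarrow> distinct xs \<and> successively (\<lambda>u v. (u, v) \<in> E) xs"

definition cycle_list :: "('a \<times> 'a) set \<Rightarrow> 'a list \<Rightarrow> bool" where
  "cycle_list E xs \<longleftrightarrow> path_list E xs \<and> (last xs, hd xs) \<in> E \<and> 3 \<le> length xs"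

definition cycle_residues :: "('a \<times> 'a) set \<Rightarrow> nat set" where
  "cycle_residues E = {length xs mod 4 | xs. cycle_list E xs}"

lemma cycle_residuesI: "cycle_list E xs \<Longrightarrow> length xs mod 4 \<in> cycle_residues E"
  by (auto simp: cycle_residues_def)

lemma finite_cycle_residues: "finite (cycle_residues E)"
  by (rule finite_subset[of _ "{..<4}"]) (auto simp: cycle_residues_def)

lemma path_list_append_iff:
  "path_list E (xs @ ys) \<longleftrightarrow> path_list E xs \<and> path_list E ys \<and> set xs \<inter> set ys = {} \<and>
     (xs = [] \<or> ys = [] \<or> (last xs, hd ys) \<in> E)"
  by (auto simp: path_list_def successively_append_iff)

lemma path_list_Nil [simp]: "path_list E []"
  by (simp add: path_list_def)

lemma path_list_singleton [simp]: "path_list E [x]"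
  by (simp add: path_list_def)

lemma path_list_Cons_iff:
  "path_list E (x # xs) \<longleftrightarrow> path_list E xs \<and> x \<notin> set xs \<and> (xs = [] \<or> (x, hd xs) \<in> E)"
  by (auto simp: path_list_def successively_Cons)

lemma path_list_rev_iff:
  assumes "sym E"
  shows "path_list E (rev xs) \<longleftrightarrow> path_list E xs"
proof -
  have "(\<lambda>u v. (v, u) \<in> E) = (\<lambda>u v. (u, v) \<in> E)"
    using assms by (auto simp: fun_eq_iff dest: symD)
  then show ?thesis unfolding path_list_def by (simp only: distinct_rev successively_rev)
qed

lemma path_list_map_nth_upt:
  assumes "path_list E xs" "j \<le> length xs"
  shows "path_list E (map ((!) xs) [i..<j])"
  using assms
  by (auto simp: path_list_def distinct_map inj_on_def nth_eq_iff_index_eq successively_conv_nth)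

lemma map_nth_upt_append:
  "i \<le> j \<Longrightarrow> j \<le> k \<Longrightarrow> map ((!) xs) [i..<k] = map ((!) xs) [i..<j] @ map ((!) xs) [j..<k]"
  using upt_add_eq_append[of i j "k - j"] by simp

lemma hd_map_nth_upt: "i < j \<Longrightarrow> hd (map ((!) xs) [i..<j]) = xs ! i"
  by (simp add: hd_map)

lemma last_map_nth_upt: "i < j \<Longrightarrow> last (map ((!) xs) [i..<j]) = xs ! (j - 1)"
  by (simp add: last_map)

section \<open>Crossing chords of a cycle\<close>

text \<open>The ends of the two chords cut the cycle into four segments, each beginning with one
  end. Each of the first four cycles closes two consecutive segments by one chord; the last two
  follow two opposite segments, one of them backwards, and use both chords.\<close>

lemma cycle_list_crossing_chords:
  assumes "sym E" "cycle_list E (A @ B @ C @ D)"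
    and ne: "A \<noteq> []" "B \<noteq> []" "C \<noteq> []" "D \<noteq> []"
    and ac: "(hd A, hd C) \<in> E" and bd: "(hd B, hd D) \<in> E"
  shows "cycle_list E (A @ B @ [hd C])" "cycle_list E (C @ D @ [hd A])"
    "cycle_list E (B @ C @ [hd D])" "cycle_list E (D @ A @ [hd B])"
    "cycle_list E (A @ [hd B] @ [hd D] @ rev C)" "cycle_list E (B @ [hd C] @ [hd A] @ rev D)"
proof -
  have sE: "\<And>u v. (u, v) \<in> E \<Longrightarrow> (v, u) \<in> E" using assms(1) by (auto dest: symD)
  note rv = path_list_rev_iff[OF assms(1)]
  have ls: "last (A @ B @ C @ D) = last D" "hd (A @ B @ C @ D) = hd A"
    using ne by auto
  have pA: "path_list E A" and pB: "path_list E B" and pC: "path_list E C" and pD: "path_list E D"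
    and e: "(last A, hd B) \<in> E" "(last B, hd C) \<in> E" "(last C, hd D) \<in> E" "(last D, hd A) \<in> E"
    and dj: "set A \<inter> set B = {}" "set A \<inter> set C = {}" "set A \<inter> set D = {}"
      "set B \<inter> set C = {}" "set B \<inter> set D = {}" "set C \<inter> set D = {}"
    using assms(2) ne unfolding cycle_list_def path_list_append_iff ls by auto
  have m: "hd A \<notin> set B" "hd A \<notin> set C" "hd A \<notin> set D" "hd B \<notin> set A" "hd B \<notin> set C" "hd B \<notin> set D"
    "hd C \<notin> set A" "hd C \<notin> set B" "hd C \<notin> set D" "hd D \<notin> set A" "hd D \<notin> set B" "hd D \<notin> set C"
    "hd A \<noteq> hd C" "hd B \<noteq> hd D"
    using dj hd_in_set[OF ne(1)] hd_in_set[OF ne(2)] hd_in_set[OF ne(3)] hd_in_set[OF ne(4)]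
    by (auto simp: disjoint_iff)
  have ln: "length A \<ge> 1" "length B \<ge> 1" "length C \<ge> 1" "length D \<ge> 1"
    using ne by (auto simp: Suc_le_eq)
  note s = cycle_list_def path_list_append_iff path_list_Cons_iff rv hd_rev last_rev
  show "cycle_list E (A @ B @ [hd C])" "cycle_list E (C @ D @ [hd A])"
    "cycle_list E (B @ C @ [hd D])" "cycle_list E (D @ A @ [hd B])"
    using pA pB pC pD e dj m ln ne ac bd sE[OF ac] sE[OF bd] by (auto simp: s)
  show "cycle_list E (A @ [hd B] @ [hd D] @ rev C)"
    using pA pC e dj m ln ne sE[OF ac] bd sE[OF e(3)] by (auto simp: s)
  show "cycle_list E (B @ [hd C] @ [hd A] @ rev D)"
    using pB pD e dj m ln ne sE[OF ac] sE[OF bd] sE[OF e(4)] by (auto simp: s)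
qed

text \<open>Modulo 4, the last two lengths add up to the total. If the total is \<open>b\<close>,
  which is odd, one of them is 2 and the other \<open>b\<close>, with sum \<open>b + 2\<close>:
  impossible. If the total is 2, each complementary pair of one-chord lengths has sum 0, so all four
  are 2; then \<open>p + q\<close> and \<open>q + r\<close> are 1, \<open>p = r\<close> and
  \<open>q = s\<close>, and the last two lengths, being even, are 2. So \<open>p\<close> and
  \<open>q\<close> are even although \<open>p + q\<close> is odd. The proof simply checks all
  residues.\<close>

lemma crossing_residues:
  fixes p q r s b :: nat
  assumes "b = 1 \<or> b = 3"
    and "(p + q + r + s) mod 4 \<in> {2, b}"
    and "(p + q + 1) mod 4 \<in> {2, b}" "(r + s + 1) mod 4 \<in> {2, b}"
    and "(q + r + 1) mod 4 \<in> {2, b}" "(s + p + 1) mod 4 \<in> {2, b}"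
    and "(p + r + 2) mod 4 \<in> {2, b}" "(q + s + 2) mod 4 \<in> {2, b}"
  shows False
proof -
  define p' q' r' s' where "p' = p mod 4" and "q' = q mod 4" and "r' = r mod 4" and "s' = s mod 4"
  have res: "p' \<in> {0, 1, 2, 3}" "q' \<in> {0, 1, 2, 3}" "r' \<in> {0, 1, 2, 3}" "s' \<in> {0, 1, 2, 3}"
    unfolding p'_def q'_def r'_def s'_def by auto
  have mod2: "(p' + q' + 1) mod 4 = (p + q + 1) mod 4" "(r' + s' + 1) mod 4 = (r + s + 1) mod 4"
    "(q' + r' + 1) mod 4 = (q + r + 1) mod 4" "(s' + p' + 1) mod 4 = (s + p + 1) mod 4"
    "(p' + r' + 2) mod 4 = (p + r + 2) mod 4" "(q' + s' + 2) mod 4 = (q + s + 2) mod 4"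
    unfolding p'_def q'_def r'_def s'_def by (intro mod_add_cong; simp)+
  have mod4: "(p' + q' + r' + s') mod 4 = (p + q + r + s) mod 4"
    unfolding p'_def q'_def r'_def s'_def by (intro mod_add_cong; simp)
  have "(p' + q' + 1) mod 4 \<in> {2, b}" "(r' + s' + 1) mod 4 \<in> {2, b}"
    "(q' + r' + 1) mod 4 \<in> {2, b}" "(s' + p' + 1) mod 4 \<in> {2, b}"
    "(p' + r' + 2) mod 4 \<in> {2, b}" "(q' + s' + 2) mod 4 \<in> {2, b}"
    "(p' + q' + r' + s') mod 4 \<in> {2, b}"
    using assms(2-) by (simp_all only: mod2 mod4)
  note cyc = this
  from assms(1) res show False
    by (elim disjE insertE emptyE; use cyc in simp)
qed

lemma no_crossing_chords:
  assumes "sym E" and b: "b = 1 \<or> b = (3::nat)"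
    and cyc: "\<forall>xs. cycle_list E xs \<longrightarrow> length xs mod 4 \<in> {2, b}"
    and v: "cycle_list E (A @ B @ C @ D)"
    and "A \<noteq> []" "B \<noteq> []" "C \<noteq> []" "D \<noteq> []"
    and "(hd A, hd C) \<in> E" "(hd B, hd D) \<in> E"
  shows False
proof -
  note cyc = cyc[rule_format] and vc = cycle_list_crossing_chords[OF assms(1,4-10)]
  show False
    using crossing_residues[of b "length A" "length B" "length C" "length D"] b
      cyc[OF v] vc[THEN cyc] by (simp add: ac_simps)
qed


section \<open>Longest paths and chords at their first vertex\<close>

locale simple_graph =
  fixes V :: "'a set" and E :: "('a \<times> 'a) set"
  assumes finite_V: "finite V" and E_subset: "E \<subseteq> V \<times> V" and sym_E: "sym E" and irrefl_E: "irrefl E"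
begin

text \<open>The condition \<open>set xs \<subseteq> V\<close> matters for one-vertex lists, which
  satisfy \<open>path_list\<close> for any vertex whatsoever.\<close>

definition longest_path :: "'a list \<Rightarrow> bool" where
  "longest_path xs \<longleftrightarrow> path_list E xs \<and> set xs \<subseteq> V \<and>
     (\<forall>ys. path_list E ys \<and> set ys \<subseteq> V \<longrightarrow> length ys \<le> length xs)"

lemma ex_longest_path:
  obtains xs where "longest_path xs"
proof -
  have "\<forall>xs. path_list E xs \<and> set xs \<subseteq> V \<longrightarrow> length xs < Suc (card V)"
    using finite_V by (metis path_list_def card_mono distinct_card le_imp_less_Suc)
  moreover have "path_list E [] \<and> set [] \<subseteq> V" by simp
  ultimately have "\<exists>xs. (path_list E xs \<and> set xs \<subseteq> V) \<and>
      (\<forall>ys. path_list E ys \<and> set ys \<subseteq> V \<longrightarrow> length ys \<le> length xs)"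
    by (rule ex_has_greatest_nat[rotated])
  then show ?thesis using that by (auto simp: longest_path_def)
qed

lemma longest_path_nonempty:
  assumes "longest_path xs" "V \<noteq> {}"
  shows "xs \<noteq> []"
proof -
  obtain v where "v \<in> V" using assms(2) by blast
  then have "length [v] \<le> length xs"
    using assms(1) unfolding longest_path_def
    by (metis empty_set empty_subsetI insert_subset list.simps(15) path_list_singleton)
  then show ?thesis by auto
qed

text \<open>A neighbour of the first vertex off the path could be prepended to it, giving a longer
  path.\<close>

lemma longest_path_neighbours:
  assumes "longest_path xs" "xs \<noteq> []"
  shows "E `` {xs ! 0} = (!) xs ` {i. i < length xs \<and> (xs ! 0, xs ! i) \<in> E}"
proof -
  have "y \<in> set xs" if "(xs ! 0, y) \<in> E" for y
  proof (rule ccontr)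
    assume "y \<notin> set xs"
    moreover have "(y, hd xs) \<in> E" using that assms(2) sym_E by (auto simp: hd_conv_nth dest: symD)
    ultimately have "path_list E (y # xs)" "set (y # xs) \<subseteq> V"
      using assms(1) that E_subset by (auto simp: longest_path_def path_list_Cons_iff)
    then have "length (y # xs) \<le> length xs" using assms(1) unfolding longest_path_def by blast
    then show False by simp
  qed
  then show ?thesis by (force simp: in_set_conv_nth)
qed

lemma card_longest_path_neighbours:
  assumes "longest_path xs" "xs \<noteq> []"
  shows "card (E `` {xs ! 0}) \<le> card {i. i < length xs \<and> (xs ! 0, xs ! i) \<in> E}"
  unfolding longest_path_neighbours[OF assms] by (rule card_image_le) simp

text \<open>This is Posa rotation: the reversed initial segment ends in \<open>xs ! 0\<close>, which
  is adjacent to \<open>xs ! a\<close>. The vertex set stays the same and the new first vertex is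
  \<open>xs ! (a - 1)\<close>.\<close>

lemma longest_path_rotate:
  assumes "longest_path xs" "0 < a" "a < length xs" "(xs ! 0, xs ! a) \<in> E"
  shows "longest_path (rev (take a xs) @ drop a xs)"
proof -
  have "path_list E (take a xs @ drop a xs)" using assms(1) by (simp add: longest_path_def)
  then have "path_list E (take a xs)" "path_list E (drop a xs)" "set (take a xs) \<inter> set (drop a xs) = {}"
    unfolding path_list_append_iff by auto
  then have "path_list E (rev (take a xs) @ drop a xs)"
    using assms(2-)
    by (auto simp: path_list_append_iff path_list_rev_iff[OF sym_E] last_rev hd_drop_conv_nth hd_conv_nth)
  moreover have "set (rev (take a xs) @ drop a xs) = set xs"
    by (metis append_take_drop_id set_append set_rev)
  moreover have "length (rev (take a xs) @ drop a xs) = length xs" using assms(3) by simp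
  ultimately show ?thesis using assms(1) unfolding longest_path_def by metis
qed

lemma nonzero_neighbour_index:
  assumes "(xs ! 0, xs ! i) \<in> E"
  shows "i \<noteq> 0"
  using assms irrefl_E by (metis irreflD)

lemma rotated_endpoint_neighbours:
  assumes b: "b = 1 \<or> b = (3::nat)"
    and cyc: "\<forall>xs. cycle_list E xs \<longrightarrow> length xs mod 4 \<in> {2, b}"
    and p: "path_list E xs"
    and a: "2 \<le> a" "a < d" "d < length xs" "(xs ! 0, xs ! a) \<in> E" "(xs ! 0, xs ! d) \<in> E"
    and c: "c < length xs" "(xs ! (a - 1), xs ! c) \<in> E"
  shows "c \<le> a"
proof (rule ccontr)
  \<comment> \<open>If \<open>c \<le> d\<close>, the chords from \<open>0\<close> to \<open>a\<close> and from \<open>a - 1\<close> to \<open>c\<close> cross in the cycle \<open>0, \<dots>, d\<close>; otherwise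
    those from \<open>0\<close> to \<open>d\<close> and from \<open>a - 1\<close> to \<open>a\<close> cross in the cycle \<open>0, \<dots>, a - 1, c, c - 1, \<dots>, a\<close>.\<close>
  assume "\<not> c \<le> a"
  then have ca: "a < c" by simp
  have lt: "a - Suc 0 < a" using a by simp
  let ?s = "\<lambda>i j. map ((!) xs) [i..<j]"
  have sE: "\<And>u v. (u, v) \<in> E \<Longrightarrow> (v, u) \<in> E" using sym_E by (auto dest: symD)
  show False
  proof (cases "c \<le> d")
    case True
    \<comment> \<open>Cutting before \<open>a - 1\<close>, \<open>a\<close> and \<open>c\<close>
      makes the four segments begin with the chord ends; \<open>2 \<le> a\<close> keeps the first
      segment nonempty.\<close>
    have eq: "?s 0 (a - 1) @ ?s (a - 1) a @ ?s a c @ ?s c (Suc d) = ?s 0 (Suc d)"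
      using True ca a map_nth_upt_append[of 0 "a - 1" "Suc d" xs]
        map_nth_upt_append[of "a - 1" a "Suc d" xs]
        map_nth_upt_append[of a c "Suc d" xs] by simp
    have "cycle_list E (?s 0 (Suc d))"
      using path_list_map_nth_upt[OF p, of "Suc d" 0] a sE
      unfolding cycle_list_def by (simp add: hd_map_nth_upt last_map_nth_upt del: upt_Suc)
    then have "cycle_list E (?s 0 (a - 1) @ ?s (a - 1) a @ ?s a c @ ?s c (Suc d))"
      unfolding eq .
    then show False
      by (rule no_crossing_chords[OF sym_E b cyc])
        (use True ca a c in \<open>simp_all add: hd_map_nth_upt del: upt_Suc\<close>)
  next
    case False
    have "?s a (Suc c) = ?s a (Suc a) @ ?s (Suc a) (Suc d) @ ?s (Suc d) (Suc c)"
      using False a map_nth_upt_append[of a "Suc a" "Suc c" xs]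
        map_nth_upt_append[of "Suc a" "Suc d" "Suc c" xs] by simp
    then have "rev (?s a (Suc c)) = rev (?s (Suc d) (Suc c)) @ rev (?s (Suc a) (Suc d)) @ rev (?s a (Suc a))"
      by (simp only: rev_append append_assoc)
    moreover have "?s 0 a = ?s 0 (a - 1) @ [xs ! (a - 1)]"
      using lt map_nth_upt_append[of 0 "a - 1" a xs] by (cases a) auto
    \<comment> \<open>The four segments begin at \<open>0\<close>, \<open>a - 1\<close>,
      \<open>d\<close> and \<open>a\<close>. The chord from \<open>a - 1\<close> to \<open>a\<close>
      is an edge of the path that the new cycle leaves out.\<close>
    ultimately have eq: "?s 0 a @ rev (?s a (Suc c)) =
        ?s 0 (a - 1) @ (xs ! (a - 1) # rev (?s (Suc d) (Suc c))) @ rev (?s (Suc a) (Suc d)) @ rev (?s a (Suc a))"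
      by simp
    have "path_list E (?s 0 a)" "path_list E (?s a (Suc c))"
      using a c by (auto intro!: path_list_map_nth_upt[OF p] simp del: upt_Suc)
    moreover have "set (?s 0 a) \<inter> set (?s a (Suc c)) = {}"
      using p c(1) by (auto simp: path_list_def nth_eq_iff_index_eq simp del: upt_Suc)
    ultimately have "cycle_list E (?s 0 a @ rev (?s a (Suc c)))"
      using a ca c sE
      by (auto simp: cycle_list_def path_list_append_iff path_list_rev_iff[OF sym_E] hd_rev last_rev
          hd_map_nth_upt last_map_nth_upt simp del: upt_Suc)
    then have "cycle_list E (?s 0 (a - 1) @ (xs ! (a - 1) # rev (?s (Suc d) (Suc c))) @
        rev (?s (Suc a) (Suc d)) @ rev (?s a (Suc a)))"
      unfolding eq .
    then show False
      by (rule no_crossing_chords[OF sym_E b cyc])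
        (use False ca a c p successively_nth[of "\<lambda>u v. (u, v) \<in> E" xs "a - 1"]
          in \<open>simp_all add: path_list_def hd_map_nth_upt last_map_nth_upt hd_rev hd_append del: upt_Suc\<close>)
  qed
qed

section \<open>Minimum degree and cycle types\<close>

theorem min_degree_3_cycle_types:
  assumes "V \<noteq> {}" and deg: "\<forall>v\<in>V. 3 \<le> card (E `` {v})"
    and b: "b = 1 \<or> b = (3::nat)"
  shows "\<exists>xs. cycle_list E xs \<and> length xs mod 4 \<notin> {2, b}"
proof (rule ccontr)
  assume "\<not> ?thesis"
  then have cyc: "\<forall>xs. cycle_list E xs \<longrightarrow> length xs mod 4 \<in> {2, b}" by blast
  \<comment> \<open>The degree bound enters here: three neighbours cannot all sit at two prescribed
    positions. Position 0 is excluded separately, by irreflexivity.\<close>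
  have third: "\<exists>i<length xs. i \<notin> {j, k} \<and> (xs ! 0, xs ! i) \<in> E"
    if "longest_path xs" for xs j k
  proof -
    have ne: "xs \<noteq> []" using longest_path_nonempty that assms(1) by blast
    then have "xs ! 0 \<in> V" using that by (auto simp: longest_path_def)
    then have "3 \<le> card {i. i < length xs \<and> (xs ! 0, xs ! i) \<in> E}"
      using deg[rule_format] card_longest_path_neighbours[OF that ne] by (meson le_trans)
    moreover have "card {j, k} \<le> 2" by (simp add: card_insert_if)
    ultimately have "\<not> {i. i < length xs \<and> (xs ! 0, xs ! i) \<in> E} \<subseteq> {j, k}"
      using card_mono[of "{j, k}" "{i. i < length xs \<and> (xs ! 0, xs ! i) \<in> E}"] by fastforce
    then show ?thesis by blast
  qed
  \<comment> \<open>Minimising over paths and chords together lets \<open>a\<close> be compared both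
    with the other chord \<open>d\<close> of the same path and with chords of the rotated
    path.\<close>
  define Q where "Q a \<longleftrightarrow> (\<exists>xs. longest_path xs \<and> 2 \<le> a \<and> a < length xs \<and> (xs ! 0, xs ! a) \<in> E)" for a
  obtain ys where "longest_path ys" by (rule ex_longest_path)
  moreover obtain a where "a < length ys" "a \<notin> {0, 1}" "(ys ! 0, ys ! a) \<in> E"
    using third[OF calculation] by blast
  moreover from this have "2 \<le> a" by auto
  ultimately have "\<exists>a. Q a" unfolding Q_def by blast
  then obtain a where "Q a" and least: "\<And>a'. Q a' \<Longrightarrow> a \<le> a'"
    by (metis (full_types) LeastI Least_le)
  then obtain xs where xs: "longest_path xs" "2 \<le> a" "a < length xs" "(xs ! 0, xs ! a) \<in> E"
    unfolding Q_def by blast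
  obtain d where d: "d < length xs" "d \<notin> {1, a}" "(xs ! 0, xs ! d) \<in> E"
    using third[OF xs(1)] by blast
  then have "2 \<le> d" using nonzero_neighbour_index[of xs d] by auto
  then have "a \<le> d" using least d xs unfolding Q_def by blast
  with d have ad: "a < d" by auto
  define ys where "ys = rev (take a xs) @ drop a xs"
  have ys: "longest_path ys" unfolding ys_def using xs by (intro longest_path_rotate) auto
  have ys0: "ys ! 0 = xs ! (a - 1)" using xs by (simp add: ys_def nth_append rev_nth)
  \<comment> \<open>Avoiding 1 makes \<open>i\<close> the position of a chord; avoiding
    \<open>a\<close> turns the bound \<open>i \<le> a\<close> into a strict one.\<close>
  obtain i where i: "i < length ys" "i \<notin> {1, a}" "(ys ! 0, ys ! i) \<in> E"
    using third[OF ys] by blast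
  have "i \<le> a"
  proof (rule ccontr)
    assume "\<not> i \<le> a"
    \<comment> \<open>The rotation moves only the positions below \<open>a\<close>.\<close>
    then have "ys ! i = xs ! i" using xs i by (simp add: ys_def nth_append)
    then have "(xs ! (a - 1), xs ! i) \<in> E" "i < length xs" using i ys0 xs by (auto simp: ys_def)
    then have "i \<le> a"
      using rotated_endpoint_neighbours[OF b cyc _ xs(2) ad d(1) xs(4) d(3)] xs(1)
      by (auto simp: longest_path_def)
    with \<open>\<not> i \<le> a\<close> show False by simp
  qed
  moreover have "i \<noteq> 0" using i nonzero_neighbour_index by blast
  ultimately have "2 \<le> i" "i < a" using i(2) by auto
  with least i ys show False unfolding Q_def by (meson not_le)
qed

text \<open>The vertex \<open>xs ! 0\<close> closes up the segment from \<open>i\<close> to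
  \<open>j\<close>. For \<open>i = 1\<close> one of the two closing edges is a path edge.\<close>

lemma chord_pair_cycle:
  assumes "path_list E xs" "0 < i" "i < j" "j < length xs" "(xs ! 0, xs ! i) \<in> E" "(xs ! 0, xs ! j) \<in> E"
  shows "\<exists>ys. cycle_list E ys \<and> length ys = j - i + 2"
proof -
  let ?ys = "xs ! 0 # map ((!) xs) [i..<Suc j]"
  have "xs ! 0 \<notin> set (map ((!) xs) [i..<Suc j])"
  proof
    assume "xs ! 0 \<in> set (map ((!) xs) [i..<Suc j])"
    then obtain k where "i \<le> k" "k \<le> j" "xs ! 0 = xs ! k" by auto
    then show False
      using assms nth_eq_iff_index_eq[of xs 0 k] unfolding path_list_def by fastforce
  qed
  then have "cycle_list E ?ys"
    using assms path_list_map_nth_upt[OF assms(1), of "Suc j" i] sym_E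
    by (auto simp: cycle_list_def path_list_Cons_iff hd_map_nth_upt last_map_nth_upt
        simp del: upt_Suc dest: symD)
  moreover have "length ?ys = j - i + 2" using assms by auto
  ultimately show ?thesis by blast
qed

lemma min_degree_4_cycle_residue_2:
  assumes "V \<noteq> {}" and deg: "\<forall>v\<in>V. 4 \<le> card (E `` {v})"
    and two: "card (cycle_residues E) \<le> 2"
  shows "2 \<in> cycle_residues E"
proof -
  obtain xs where xs: "longest_path xs" by (rule ex_longest_path)
  have ne: "xs \<noteq> []" using longest_path_nonempty xs assms(1) by blast
  define I where "I = {i. i < length xs \<and> (xs ! 0, xs ! i) \<in> E}"
  have "xs ! 0 \<in> V" using xs ne by (auto simp: longest_path_def)
  then have I4: "4 \<le> card I"
    using deg[rule_format] card_longest_path_neighbours[OF xs ne] unfolding I_def by (meson le_trans)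
  have fin: "finite I" unfolding I_def by simp
  have Ine: "I \<noteq> {}" using I4 by auto
  have type: "(j - i + 2) mod 4 \<in> cycle_residues E" if ij: "i \<in> I" "j \<in> I" "i < j" for i j
  proof -
    have "0 < i" using ij nonzero_neighbour_index[of xs i] by (auto simp: I_def)
    then obtain ys where "cycle_list E ys" "length ys = j - i + 2"
      using chord_pair_cycle[of xs i j] ij xs unfolding I_def longest_path_def by blast
    then show ?thesis using cycle_residuesI[of E ys] by simp
  qed
  \<comment> \<open>Measured from the least position \<open>m\<close>, the at least three other
    positions yield at most two types. So two of them agree modulo 4, and their difference gives the
    cycle of type 2.\<close>
  define m where "m = Min I"
  have m: "m \<in> I" "\<And>i. i \<in> I \<Longrightarrow> m \<le> i" using fin Ine by (auto simp: m_def)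
  let ?f = "\<lambda>j. (j - m + 2) mod 4"
  have "finite (cycle_residues E)" by (rule finite_cycle_residues)
  moreover have "?f ` (I - {m}) \<subseteq> cycle_residues E" using type m by fastforce
  ultimately have "card (?f ` (I - {m})) \<le> 2" using two card_mono le_trans by blast
  moreover have "3 \<le> card (I - {m})" using I4 m fin by simp
  ultimately have "\<not> inj_on ?f (I - {m})" using card_image by fastforce
  then obtain i' j' where "i' \<in> I" "j' \<in> I" "i' \<noteq> j'" "?f i' = ?f j'" by (auto simp: inj_on_def)
  then obtain i j where ij: "i \<in> I" "j \<in> I" "i < j" "?f j = ?f i"
    by (cases "i' < j'") (auto intro: that)
  have "4 dvd (j - m + 2) - (i - m + 2)"
    using ij(3,4) mod_eq_dvd_iff_nat[of "i - m + 2" "j - m + 2" 4] by simp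
  moreover have "(j - m + 2) - (i - m + 2) = j - i" using m(2)[OF ij(1)] by simp
  ultimately have "(j - i) mod 4 = 0" by simp
  then have "(j - i + 2) mod 4 = 2" using mod_add_left_eq[of "j - i" 4 2] by simp
  with type[OF ij(1-3)] show ?thesis by simp
qed

end


section \<open>Vertex lists and arc walks\<close>

lemma set_zip_shift_subset_iff:
  "set (zip (u # xs) (xs @ [w])) \<subseteq> E \<longleftrightarrow>
     successively (\<lambda>u v. (u, v) \<in> E) (u # xs) \<and> (last (u # xs), w) \<in> E"
  by (induction xs arbitrary: u) auto

text \<open>The list \<open>zip xs (rotate1 xs)\<close> consists of the arcs of the cycle, the
  closing one included; this form matches cycles given as arc walks.\<close>

lemma cycle_list_altdef:
  "cycle_list E xs \<longleftrightarrow> distinct xs \<and> 3 \<le> length xs \<and> set (zip xs (rotate1 xs)) \<subseteq> E"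
proof (cases xs)
  case (Cons u ys)
  then show ?thesis
    using set_zip_shift_subset_iff[of u ys u E] by (auto simp: cycle_list_def path_list_def)
qed (simp add: cycle_list_def)

lemma pcas_zip_shift: "pcas u (zip (u # xs) (xs @ [w])) w"
  by (induction xs arbitrary: u) auto

lemma pcas_map_fst_snd:
  "pcas u p w \<Longrightarrow> map fst p @ [w] = u # map snd p"
  by (induction p arbitrary: u) auto

lemma tl_pawalk_verts: "pcas u p w \<Longrightarrow> tl (pawalk_verts u p) = map snd p"
proof (induction p arbitrary: u)
  case (Cons e p)
  then show ?case by (cases e; cases p) auto
qed simp

lemma (in pair_wf_digraph) graph_cycle_iff_cycle_list:
  "graph_cycle G p \<longleftrightarrow> (\<exists>xs. cycle_list (parcs G) xs \<and> p = zip xs (rotate1 xs))"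
proof
  assume "graph_cycle G p"
  then obtain u where u: "awalk u p u" "distinct (tl (pawalk_verts u p))" and l: "3 \<le> length p"
    unfolding graph_cycle_def cycle_def by auto
  have cas: "pcas u p u" and sub: "set p \<subseteq> parcs G" using u(1) by (auto simp: awalk_def)
  let ?xs = "map fst p"
  obtain zs where zs: "?xs = u # zs" using pcas_map_fst_snd[OF cas] l by (cases p) auto
  \<comment> \<open>As the walk is closed, its targets are its sources shifted by one.\<close>
  have "map snd p = rotate1 ?xs" using pcas_map_fst_snd[OF cas] zs by auto
  moreover from this have p: "p = zip ?xs (rotate1 ?xs)" by (metis zip_map_fst_snd)
  moreover have "distinct (rotate1 ?xs)" using u(2) tl_pawalk_verts[OF cas] calculation by simp
  ultimately have "cycle_list (parcs G) ?xs"
    using l sub unfolding cycle_list_altdef by (metis distinct1_rotate length_map)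
  then show "\<exists>xs. cycle_list (parcs G) xs \<and> p = zip xs (rotate1 xs)" using p by blast
next
  assume "\<exists>xs. cycle_list (parcs G) xs \<and> p = zip xs (rotate1 xs)"
  then obtain xs where xs: "cycle_list (parcs G) xs" "p = zip xs (rotate1 xs)" by blast
  then have d: "distinct xs" "3 \<le> length xs" "set p \<subseteq> parcs G" by (auto simp: cycle_list_altdef)
  then obtain u zs where zs: "xs = u # zs" by (cases xs) auto
  have cas: "pcas u p u" using pcas_zip_shift[of u zs u] xs(2) zs by simp
  moreover have "u \<in> pverts G"
    using d xs(2) zs arc_fst_in_verts[of "hd p"] by (cases zs) auto
  ultimately have "awalk u p u" using d by (simp add: awalk_def)
  moreover have "distinct (tl (pawalk_verts u p))"
    unfolding tl_pawalk_verts[OF cas] using d xs(2) by simp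
  moreover have "3 \<le> length p" using d xs(2) by simp
  moreover from this have "p \<noteq> []" by auto
  ultimately show "graph_cycle G p" unfolding graph_cycle_def cycle_def by auto
qed

lemma (in pair_wf_digraph) cycle_types_eq_cycle_residues:
  "cycle_types G = cycle_residues (parcs G)"
  unfolding cycle_types_def cycle_residues_def graph_cycle_iff_cycle_list by force

lemma out_degree_with_proj: "out_degree (with_proj G) v = card (parcs G `` {v})"
proof -
  have "out_arcs (with_proj G) v = Pair v ` (parcs G `` {v})"
    by (auto simp: out_arcs_def)
  then show ?thesis unfolding out_degree_def by (simp add: card_image inj_on_def)
qed

lemma card_cycle_arcs_Image:
  fixes xs :: "'a list"
  defines "S \<equiv> set (zip xs (rotate1 xs))"
  assumes d: "distinct xs" "3 \<le> length xs" and v: "v \<in> set xs"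
  shows "card ((S \<union> S\<inverse>) `` {v}) = 2"
proof -
  let ?n = "length xs"
  have S: "S = {(xs ! i, xs ! (Suc i mod ?n)) | i. i < ?n}"
    by (auto simp: S_def set_zip nth_rotate1)
  obtain i where i: "i < ?n" "v = xs ! i" using v by (auto simp: in_set_conv_nth)
  \<comment> \<open>The positions \<open>s\<close> and \<open>r\<close> are the cyclic successor and
    predecessor of \<open>i\<close>; they differ because the length is at least 3.\<close>
  define s where "s = (if Suc i = ?n then 0 else Suc i)"
  define r where "r = (if i = 0 then ?n - 1 else i - 1)"
  have sr: "s < ?n" "r < ?n" "s \<noteq> r" using i d by (auto simp: s_def r_def)
  have mod_s: "Suc i mod ?n = s" using i by (auto simp: s_def)
  have mod_r: "Suc j mod ?n = i \<longleftrightarrow> j = r" if "j < ?n" for j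
    using that i by (cases "Suc j = ?n") (auto simp: r_def)
  have "S `` {v} = {xs ! s}"
    using i d mod_s by (auto simp: S nth_eq_iff_index_eq)
  moreover have "S\<inverse> `` {v} = {xs ! r}"
  proof -
    have "xs ! (Suc j mod ?n) = v \<longleftrightarrow> j = r" if "j < ?n" for j
    proof -
      have "Suc j mod ?n < ?n" using i(1) by (intro mod_less_divisor) linarith
      then show ?thesis using i d mod_r[OF that] by (simp add: nth_eq_iff_index_eq)
    qed
    then show ?thesis using sr by (auto simp: S)
  qed
  ultimately have "(S \<union> S\<inverse>) `` {v} = {xs ! s, xs ! r}" by auto
  moreover have "xs ! s \<noteq> xs ! r" using sr d by (simp add: nth_eq_iff_index_eq)
  ultimately show ?thesis by simp
qed

section \<open>Odd cycles and bipartiteness\<close>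

text \<open>At a repeated vertex a closed walk splits into two shorter closed walks whose lengths
  add up to the original one, so one of them is odd. Irreflexivity rules out length 1.\<close>

lemma odd_closed_walk_imp_odd_cycle:
  assumes "irrefl E"
    and "successively (\<lambda>u v. (u, v) \<in> E) ws" "(last ws, hd ws) \<in> E" "odd (length ws)"
  shows "\<exists>xs. cycle_list E xs \<and> odd (length xs)"
  using assms(2-)
proof (induction ws rule: length_induct)
  case (1 ws)
  show ?case
  proof (cases "distinct ws")
    case True
    have "length ws \<noteq> 1" using 1(3) assms(1) by (auto simp: length_Suc_conv irrefl_def)
    then have "3 \<le> length ws" using 1(4) by presburger
    then show ?thesis using 1(2-) True by (auto simp: cycle_list_def path_list_def)
  next
    case False
    then obtain a x b c where ws: "ws = a @ [x] @ b @ [x] @ c" using not_distinct_decomp by blast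
    have "ws = a @ ((x # b) @ [x]) @ c" using ws by simp
    then have "successively (\<lambda>u v. (u, v) \<in> E) ((x # b) @ [x])"
      using 1(2) successively_append_iff by metis
    then have 2: "successively (\<lambda>u v. (u, v) \<in> E) (x # b)" "(last (x # b), hd (x # b)) \<in> E"
      unfolding successively_append_iff by simp_all
    have 3: "successively (\<lambda>u v. (u, v) \<in> E) (a @ x # c)"
    proof -
      have "ws = a @ (x # b) @ (x # c)" using ws by simp
      then show ?thesis using 1(2) by (auto simp only: successively_append_iff hd_append list.distinct if_False list.sel)
    qed
    have 4: "(last (a @ x # c), hd (a @ x # c)) \<in> E"
      using 1(3) unfolding ws by (cases a) (simp_all split: if_splits)
    have "odd (length (x # b)) \<or> odd (length (a @ x # c))" using 1(4) ws by auto
    moreover have "length (x # b) < length ws" "length (a @ x # c) < length ws" using ws by auto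
    ultimately show ?thesis using 1(1) 2 3 4 by blast
  qed
qed

lemma relpow_imp_walk:
  "(u, v) \<in> E ^^ n \<Longrightarrow>
     \<exists>ws. length ws = Suc n \<and> hd ws = u \<and> last ws = v \<and> successively (\<lambda>u v. (u, v) \<in> E) ws"
proof (induction n arbitrary: v)
  case 0
  then show ?case by (intro exI[of _ "[u]"]) auto
next
  case (Suc n)
  then obtain y where "(u, y) \<in> E ^^ n" and y: "(y, v) \<in> E" by auto
  with Suc.IH obtain ws where
    "length ws = Suc n" "hd ws = u" "last ws = y" "successively (\<lambda>u v. (u, v) \<in> E) ws" by blast
  with y show ?case
    by (intro exI[of _ "ws @ [v]"]) (auto simp: successively_append_iff hd_append)
qed

lemma sym_relpow: "sym E \<Longrightarrow> (u, v) \<in> E ^^ n \<Longrightarrow> (v, u) \<in> E ^^ n"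
proof (induction n arbitrary: v)
  case (Suc n)
  then obtain y where "(u, y) \<in> E ^^ n" "(y, v) \<in> E" by auto
  with Suc show ?case by (metis relpow_Suc_I2 symD)
qed auto

context simple_graph
begin

lemma bipartition_if_no_odd_cycle:
  assumes conn: "\<forall>u\<in>V. \<forall>v\<in>V. (u, v) \<in> E\<^sup>*"
    and no_odd: "\<forall>xs. cycle_list E xs \<longrightarrow> even (length xs)"
  shows "\<exists>U W. V = U \<union> W \<and> U \<inter> W = {} \<and> E \<subseteq> U \<times> W \<union> W \<times> U"
proof (cases "V = {}")
  case True
  then show ?thesis using E_subset by auto
next
  case False
  then obtain r where r: "r \<in> V" by blast
  \<comment> \<open>The classes collect the vertices reached from \<open>r\<close> by walks of even
    and of odd length; a common vertex would give an odd closed walk through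
    \<open>r\<close>.\<close>
  define U where "U = {v \<in> V. \<exists>n. even n \<and> (r, v) \<in> E ^^ n}"
  define W where "W = {v \<in> V. \<exists>n. odd n \<and> (r, v) \<in> E ^^ n}"
  have "V = U \<union> W"
    using conn r unfolding U_def W_def by (auto simp: rtrancl_power) blast
  moreover have "U \<inter> W = {}"
  proof (rule ccontr)
    assume "U \<inter> W \<noteq> {}"
    then obtain v n m where "even n" "odd m" and w: "(r, v) \<in> E ^^ n" "(r, v) \<in> E ^^ m"
      by (auto simp: U_def W_def)
    moreover have "(r, r) \<in> E ^^ (n + m)"
      using w sym_relpow[OF sym_E w(2)] by (auto simp: relpow_add)
    ultimately obtain k where k: "even k" "(r, r) \<in> E ^^ Suc k"
      by (metis even_add oddE Suc_eq_plus1 dvd_triv_left)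
    \<comment> \<open>The last arc is split off because a closed walk is given by its vertices
      without the final return to \<open>r\<close>.\<close>
    then obtain y where "(r, y) \<in> E ^^ k" and y: "(y, r) \<in> E" by auto
    then obtain ws where "length ws = Suc k" "hd ws = r" "last ws = y"
      "successively (\<lambda>u v. (u, v) \<in> E) ws"
      using relpow_imp_walk by metis
    then show False
      using odd_closed_walk_imp_odd_cycle[OF irrefl_E, of ws] y k(1) no_odd by auto
  qed
  moreover have "E \<subseteq> U \<times> W \<union> W \<times> U"
  proof (rule subrelI)
    fix u v assume uv: "(u, v) \<in> E"
    then have V: "u \<in> V" "v \<in> V" using E_subset by auto
    have step: "(r, v) \<in> E ^^ Suc n" if "(r, u) \<in> E ^^ n" for n
      using that uv by auto
    have "v \<in> U" if "u \<in> W"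
      using that V step unfolding U_def W_def mem_Collect_eq by (meson even_Suc)
    moreover have "v \<in> W" if "u \<in> U"
      using that V step unfolding U_def W_def mem_Collect_eq by (meson even_Suc)
    ultimately show "(u, v) \<in> U \<times> W \<union> W \<times> U" using V \<open>V = U \<union> W\<close> by auto
  qed
  ultimately show ?thesis by blast
qed

section \<open>Graphs of degree 2 and of degree at least 4\<close>

text \<open>The cycle already uses both edges at each of its vertices, so no edge leaves it and, by
  connectedness, it is the whole graph.\<close>

lemma two_regular_cycle:
  assumes conn: "\<forall>u\<in>V. \<forall>v\<in>V. (u, v) \<in> E\<^sup>*"
    and deg: "\<forall>v\<in>V. card (E `` {v}) = 2"
    and xs: "cycle_list E xs"
  shows "V = set xs" "E = set (zip xs (rotate1 xs)) \<union> (set (zip xs (rotate1 xs)))\<inverse>"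
proof -
  let ?S = "set (zip xs (rotate1 xs))"
  let ?T = "?S \<union> ?S\<inverse>"
  have d: "distinct xs" "3 \<le> length xs" "?S \<subseteq> E" using xs by (auto simp: cycle_list_altdef)
  then have T: "?T \<subseteq> E" using sym_E by (auto dest: symD)
  have Txs: "?T \<subseteq> set xs \<times> set xs" by (auto dest: set_zip_leftD set_zip_rightD)
  have sub: "set xs \<subseteq> V"
  proof
    fix v assume "v \<in> set xs"
    then have "?T `` {v} \<noteq> {}" using card_cycle_arcs_Image[OF d(1,2)] by fastforce
    then show "v \<in> V" using T E_subset by blast
  qed
  have nb: "E `` {v} = ?T `` {v}" if "v \<in> set xs" for v
  proof -
    have c: "card (E `` {v}) = 2" using deg sub that by blast
    then have "finite (E `` {v})" using card_ge_0_finite[of "E `` {v}"] by simp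
    moreover have "?T `` {v} \<subseteq> E `` {v}" using T by blast
    ultimately show ?thesis
      using c card_cycle_arcs_Image[OF d(1,2) that] by (metis card_subset_eq)
  qed
  obtain r where r: "r \<in> set xs" using d by (cases xs) auto
  have "v \<in> set xs" if "(r, v) \<in> E\<^sup>*" for v
    using that r
  proof (induction rule: rtrancl_induct)
    case (step y z)
    then have "z \<in> ?T `` {y}" using nb by blast
    then show ?case using Txs by blast
  qed
  then show V: "V = set xs" using conn r sub by blast
  show "E = ?T"
  proof
    show "E \<subseteq> ?T"
    proof clarify
      fix u v assume "(u, v) \<in> E" "(u, v) \<notin> ?S"
      moreover from this have "u \<in> set xs" using E_subset V by auto
      ultimately show "(v, u) \<in> ?S" using nb[of u] by blast
    qed
  qed (rule T)
qed

theorem non_bipartite_min_degree_4_cycle_types: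
  assumes "V \<noteq> {}" and deg: "\<forall>v\<in>V. 4 \<le> card (E `` {v})"
    and xs: "cycle_list E xs" "odd (length xs)"
  shows "3 \<le> card (cycle_residues E)"
proof (rule ccontr)
  assume "\<not> ?thesis"
  then have two: "card (cycle_residues E) \<le> 2" by simp
  define b where "b = length xs mod 4"
  have b: "b = 1 \<or> b = 3" using xs(2) unfolding b_def by presburger
  \<comment> \<open>Types 2 and \<open>b\<close> both occur, so with at most two types there are no
    others.\<close>
  have sub: "{2, b} \<subseteq> cycle_residues E"
    using min_degree_4_cycle_residue_2[OF assms(1) deg two] cycle_residuesI[OF xs(1)] by (simp add: b_def)
  have "card {2, b} = 2" using b by auto
  then have "cycle_residues E = {2, b}"
    using card_seteq[OF finite_cycle_residues sub] two by simp
  moreover have "\<exists>ys. cycle_list E ys \<and> length ys mod 4 \<notin> {2, b}"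
    using deg by (intro min_degree_3_cycle_types[OF assms(1) _ b]) force
  ultimately show False using cycle_residuesI by blast
qed

end

section \<open>Regular Euler graphs\<close>

lemma odd_cycle_graph_imp_regular_graph:
  assumes "odd_cycle_graph G"
  shows "regular_graph G"
proof -
  interpret pair_graph G using assms by (simp add: odd_cycle_graph_def)
  obtain p where p: "graph_cycle G p" "pverts G = fst ` set p" "parcs G = set p \<union> (set p)\<inverse>"
    using assms unfolding odd_cycle_graph_def by blast
  obtain xs where xs: "cycle_list (parcs G) xs" "p = zip xs (rotate1 xs)"
    using p(1) graph_cycle_iff_cycle_list by blast
  have "pverts G = set xs" unfolding p(2) xs(2) by (metis length_rotate1 list.set_map map_fst_zip)
  then have "out_degree (with_proj G) v = 2" if "v \<in> pverts G" for v
    using that xs card_cycle_arcs_Image[of xs v] p(3)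
    by (simp add: out_degree_with_proj cycle_list_altdef)
  then show ?thesis unfolding regular_graph_def by blast
qed

theorem theorem28:
  fixes G :: "'a pair_pre_digraph"
  assumes "euler_graph G"
    and "card (cycle_types G) \<le> 2"
  shows "regular_graph G \<longleftrightarrow>
    odd_cycle_graph G \<or> (regular_graph G \<and> bipartite_graph G \<and> euler_graph G)"
proof -
  interpret pair_graph G using assms(1) by (simp add: euler_graph_def)
  interpret simple_graph "pverts G" "parcs G"
  proof
    show "parcs G \<subseteq> pverts G \<times> pverts G" using arc_fst_in_verts arc_snd_in_verts by fastforce
    show "sym (parcs G)" using arcs_symmetric by (auto intro: symI)
    show "irrefl (parcs G)" using pair_no_loops by (force simp: irrefl_def)
  qed (rule pair_finite_verts)
  have conn: "\<forall>u\<in>pverts G. \<forall>v\<in>pverts G. (u, v) \<in> (parcs G)\<^sup>*"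
  proof -
    have "strongly_connected (with_proj G)"
      using assms(1) sym_arcs
      by (intro symmetric_connected_imp_strongly_connected) (auto simp: euler_graph_def)
    then show ?thesis
      unfolding strongly_connected_def reachable_def by (auto intro: rtrancl_on_rtranclI)
  qed
  have ne: "pverts G \<noteq> {}" using assms(1) E_subset by (auto simp: euler_graph_def)
  \<comment> \<open>This is the substantial direction; for the converse only the regularity of odd
    cycle graphs has to be shown.\<close>
  have "odd_cycle_graph G \<or> bipartite_graph G" if reg: "regular_graph G"
  proof (cases "bipartite_graph G")
    case False
    then obtain xs where xs: "cycle_list (parcs G) xs" "odd (length xs)"
      using bipartition_if_no_odd_cycle[OF conn] unfolding bipartite_graph_def by blast
    obtain k where k: "\<forall>v\<in>pverts G. card (parcs G `` {v}) = k"
      using reg unfolding regular_graph_def out_degree_with_proj by blast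
    obtain u w where uw: "(u, w) \<in> parcs G" using assms(1) by (auto simp: euler_graph_def)
    then have u: "u \<in> pverts G" using E_subset by blast
    have "even k" using assms(1) u k unfolding euler_graph_def out_degree_with_proj by metis
    moreover have "k \<noteq> 0"
    proof -
      \<comment> \<open>Finiteness is needed since \<open>card\<close> is 0 on infinite sets
        too.\<close>
      have "finite (parcs G `` {u})" using finite_subset[OF _ finite_V] E_subset by blast
      then show ?thesis using k u uw by (metis ImageI card_0_eq empty_iff singletonI)
    qed
    moreover have "\<not> 4 \<le> k"
      using non_bipartite_min_degree_4_cycle_types[OF ne _ xs] k assms(2)
      by (auto simp: cycle_types_eq_cycle_residues)
    \<comment> \<open>The degree is even, positive and below 4.\<close>
    ultimately have "k = 2" by presburger
    note cyc = two_regular_cycle[OF conn k[unfolded \<open>k = 2\<close>] xs(1)]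
    have "odd_cycle_graph G"
      unfolding odd_cycle_graph_def
    proof (intro conjI exI)
      show "graph_cycle G (zip xs (rotate1 xs))" using xs(1) graph_cycle_iff_cycle_list by blast
      show "pverts G = fst ` set (zip xs (rotate1 xs))"
        using cyc(1) by (metis length_rotate1 list.set_map map_fst_zip)
      show "parcs G = set (zip xs (rotate1 xs)) \<union> (set (zip xs (rotate1 xs)))\<inverse>" by (rule cyc(2))
    qed (use xs(2) in auto)
    then show ?thesis ..
  qed simp
  then show ?thesis using odd_cycle_graph_imp_regular_graph assms(1) by blast
qed

end
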